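(* Let $n\ge 1$ and let $Y_1,\dots,Y_n$ be $\mathbb{Z}_+$-valued random variables on a common probability space. For each $i\in\{1,\dots,n\}$ let $c_i\in\mathbb{N}=\{1,2,\dots\}$, with $c_i=1$ for at least one $i$, and let $\mathcal{A}_i\subset\{1,\dots,n\}$ be a set with $i\in\mathcal{A}_i$ such that $Y_i$ is independent of the collection $(Y_j)_{j\in\mathcal{A}_i^c}$, where $\mathcal{A}_i^c=\{1,\dots,n\}\setminus\mathcal{A}_i$. Let $Z_n=\sum_{i=1}^n c_iY_i$, let $\lambda=\mathbb{E}(Z_n)$ with $0<\lambda<\infty$, and let $\mathcal{P}_\lambda$ be the Poisson distribution with parameter $\lambda$. Then $$d_{TV}(Z_n,\mathcal{P}_\lambda)\le \frac{1}{\max(1,\lambda)}\sum_{i=1}^{n}\left\{\sum_{j\in\mathcal{A}_i}c_ic_j\left[\mathbb{E}(Y_iY_j)+\mathbb{E}(Y_i)\mathbb{E}(Y_j)\right]-c_i\mathbb{E}(Y_i)\right\}.$$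
   Context: $\mathbb{Z}_+=\{0,1,2,\dots\}$. The Poisson distribution $\mathcal{P}_\lambda$ has probability mass function $k\mapsto e^{-\lambda}\lambda^k/k!$ for $k\in\mathbb{Z}_+$. For $\mathbb{Z}_+$-valued random variables (or their laws) $Y,Z$, the total variation distance is $d_{TV}(Y,Z)=\sup_{A\subseteq\mathbb{Z}_+}|\mathbb{P}(Y\in A)-\mathbb{P}(Z\in A)|$. The right-hand side of the bound is interpreted as $+\infty$ if some expectation $\mathbb{E}(Y_iY_j)$ appearing in it is infinite. *)

theory Defs
  imports "HOL-Probability.Probability"
begin

(* The supremum is over all subsets of the natural numbers, so this is meant for probability
   measures P and Q on the full power set of nat; it is then a supremum over a nonempty
   family in [0, 1]. *)
definition tv_dist :: "nat measure \<Rightarrow> nat measure \<Rightarrow> real" where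
  "tv_dist P Q = (SUP A. \<bar>measure P A - measure Q A\<bar>)"

(* Extended-valued, since the mixed moments of integrable variables may be infinite (the Bochner
   integral would give 0 there). The type ereal rather than ennreal is the target because
   subtraction on ennreal truncates at 0. *)
definition ext_expectation :: "'a measure \<Rightarrow> ('a \<Rightarrow> nat) \<Rightarrow> ereal" where
  "ext_expectation M X = enn2ereal (\<integral>\<^sup>+ \<omega>. of_nat (X \<omega>) \<partial>M)"

(* Independence of two random variables whose value types may differ; the library's indep_var
   requires both variables to have the same value type. *)
definition (in prob_space) indep_rv ::
  "'b measure \<Rightarrow> ('a \<Rightarrow> 'b) \<Rightarrow> 'c measure \<Rightarrow> ('a \<Rightarrow> 'c) \<Rightarrow> bool" where
  "indep_rv S X T W \<longleftrightarrow>
     random_variable S X \<and> random_variable T W \<and>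
     indep_set
       (sigma_sets (space M) {X -` A \<inter> space M | A. A \<in> sets S})
       (sigma_sets (space M) {W -` A \<inter> space M | A. A \<in> sets T})"

lemma (in prob_space) indep_rv_eq_indep_var: "indep_rv S X T W \<longleftrightarrow> indep_var S X T W"
  unfolding indep_rv_def indep_var_eq by simp

end

theory Submission
  imports Defs
begin

text \<open>The proof is by the Stein-Chen method. For each set \<open>A\<close> of natural numbers the equation
  \<open>lam * g k - k * g (k - 1) = 1\<^sub>A k - P A\<close>, where \<open>P\<close> is the Poisson law, has an explicit solution
  \<open>g\<close>, whose increments are bounded by \<open>(1 - exp (- lam)) / lam\<close> because the ratio of distribution
  function to mass function increases and the ratio of tail to mass function decreases.
  Writing \<open>Z = W\<^sub>i + V\<^sub>i\<close>, where \<open>V\<^sub>i\<close> collects the summands with index in \<open>\<A> i\<close> and \<open>W\<^sub>i\<close> is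
  independent of \<open>Y i\<close>, both \<open>E (Y i) * E (g Z)\<close> and \<open>E (Y i * g (Z - 1))\<close> are compared with
  \<open>E (Y i) * E (g W\<^sub>i) = E (Y i * g W\<^sub>i)\<close>. In the second comparison only \<open>V\<^sub>i - 1\<close> increments
  occur, as \<open>V\<^sub>i \<ge> 1\<close> where \<open>Y i > 0\<close>; this produces the negative term of the bound.\<close>

section \<open>The Poisson mass function: recursion, normalisation and ratio estimates\<close>

text \<open>This recursion replaces the explicit formula with factorials in most of the algebra
  below; hence \<open>pmf_poisson\<close> is often removed from the simpset there.\<close>

lemma pmf_poisson_Suc:
  assumes "0 < lam"
  shows "real (Suc k) * pmf (poisson_pmf lam) (Suc k) = lam * pmf (poisson_pmf lam) k"
  using assms by (simp del: of_nat_Suc)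

lemma sums_pmf_poisson:
  assumes "0 < lam"
  shows "pmf (poisson_pmf lam) sums 1"
proof -
  have "(\<lambda>k. lam ^ k /\<^sub>R fact k * exp (- lam)) sums (exp lam * exp (- lam))"
    by (intro sums_mult2 exp_converges)
  moreover have "exp lam * exp (- lam) = 1"
    by (simp add: exp_minus)
  moreover have "pmf (poisson_pmf lam) = (\<lambda>k. lam ^ k /\<^sub>R fact k * exp (- lam))"
    using assms by (auto simp: divide_inverse)
  ultimately show ?thesis
    by simp
qed

text \<open>Termwise, \<open>lam * p i = (i + 1) * p (i + 1)\<close> with
  \<open>i + 1 \<le> k + 1\<close>. The shifted sum misses \<open>p 0 = exp (- lam)\<close>.
  Retaining this missing term, instead of the plain monotonicity of the ratio, is what later yields
  the factor \<open>1 - exp (- lam)\<close>.\<close>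

lemma poisson_cdf_ratio_le:
  assumes "0 < lam"
  shows "lam * (\<Sum>i\<le>k. pmf (poisson_pmf lam) i)
    \<le> real (Suc k) * ((\<Sum>i\<le>Suc k. pmf (poisson_pmf lam) i) - exp (- lam))"
proof -
  have "lam * (\<Sum>i\<le>k. pmf (poisson_pmf lam) i) =
      (\<Sum>i\<le>k. real (Suc i) * pmf (poisson_pmf lam) (Suc i))"
    unfolding pmf_poisson_Suc[OF assms] sum_distrib_left ..
  also have "\<dots> \<le> (\<Sum>i\<le>k. real (Suc k) * pmf (poisson_pmf lam) (Suc i))"
    by (intro sum_mono mult_right_mono) auto
  also have "\<dots> = real (Suc k) * ((\<Sum>i\<le>Suc k. pmf (poisson_pmf lam) i) - exp (- lam))"
    using assms unfolding sum.atMost_Suc_shift sum_distrib_left[symmetric] by simp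
  finally show ?thesis .
qed

text \<open>The two tails start one index apart, so their series are compared term by term: in
  \<open>(i + k + 2) * p (i + k + 2) = lam * p (i + k + 1)\<close> the first factor is at least
  \<open>k + 1\<close>.\<close>

lemma poisson_tail_ratio_le:
  assumes "0 < lam"
  shows "real (Suc k) * (1 - (\<Sum>i\<le>Suc k. pmf (poisson_pmf lam) i))
    \<le> lam * (1 - (\<Sum>i\<le>k. pmf (poisson_pmf lam) i))"
proof (rule sums_le)
  let ?p = "pmf (poisson_pmf lam)"
  have tail: "(\<lambda>i. ?p (i + Suc m)) sums (1 - (\<Sum>i\<le>m. ?p i))" for m
    using sums_split_initial_segment[OF sums_pmf_poisson[OF assms], of "Suc m"]
    by (simp only: lessThan_Suc_atMost)
  show "(\<lambda>i. real (Suc k) * ?p (i + Suc (Suc k))) sums (real (Suc k) * (1 - (\<Sum>i\<le>Suc k. ?p i)))"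
    by (intro sums_mult tail)
  show "(\<lambda>i. lam * ?p (i + Suc k)) sums (lam * (1 - (\<Sum>i\<le>k. ?p i)))"
    by (intro sums_mult tail)
  fix i
  have "real (Suc k) * ?p (i + Suc (Suc k)) \<le> real (Suc (i + Suc k)) * ?p (Suc (i + Suc k))"
    unfolding add_Suc_right by (intro mult_right_mono) auto
  also have "\<dots> = lam * ?p (i + Suc k)"
    by (rule pmf_poisson_Suc[OF assms])
  finally show "real (Suc k) * ?p (i + Suc (Suc k)) \<le> lam * ?p (i + Suc k)" .
qed

section \<open>The Stein equation and the increments of its solution\<close>

text \<open>The solution of the Stein equation at \<open>k + 1\<close>; shifting the argument avoids the irrelevant value at 0.\<close>
definition poisson_stein :: "real \<Rightarrow> nat set \<Rightarrow> nat \<Rightarrow> real" where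
  "poisson_stein lam A k =
     (measure (poisson_pmf lam) (A \<inter> {..k}) -
      measure (poisson_pmf lam) A * measure (poisson_pmf lam) {..k}) / (lam * pmf (poisson_pmf lam) k)"

lemma measure_pmf_Int_atMost_Suc:
  "measure (measure_pmf p) (A \<inter> {..Suc k}) =
     measure (measure_pmf p) (A \<inter> {..k}) + indicator A (Suc k) * pmf p (Suc k)"
proof (cases "Suc k \<in> A")
  case True
  then have "A \<inter> {..Suc k} = insert (Suc k) (A \<inter> {..k})"
    by (auto simp: le_Suc_eq)
  then show ?thesis
    using True by (simp add: measure_measure_pmf_finite)
next
  case False
  then have "A \<inter> {..Suc k} = A \<inter> {..k}"
    by (auto simp: le_Suc_eq)
  then show ?thesis
    using False by simp
qed

lemma measure_pmf_atMost_Suc: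
  "measure (measure_pmf p) {..Suc k} = measure (measure_pmf p) {..k} + pmf p (Suc k)"
  using measure_pmf_Int_atMost_Suc[of p UNIV k] by simp

text \<open>For \<open>k = 0\<close> the truncated \<open>k - 1\<close> is harmless, since its term
  has coefficient 0. For \<open>k = m + 1\<close> the recursion of the mass function brings both
  terms over the denominator \<open>p k\<close>; the numerators then differ only by the contribution
  \<open>(indicator A k - P A) * p k\<close> of the point \<open>k\<close>.\<close>

lemma poisson_stein_equation:
  assumes "0 < lam"
  shows "lam * poisson_stein lam A k - real k * poisson_stein lam A (k - 1) =
    indicator A k - measure (poisson_pmf lam) A"
proof (cases k)
  case 0
  have "A \<inter> {0} = (if 0 \<in> A then {0} else {})"
    by auto
  then show ?thesis
    using assms 0 by (simp add: poisson_stein_def measure_pmf_single field_simps)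
next
  case (Suc m)
  let ?p = "pmf (poisson_pmf lam)"
  have pos: "?p m > 0" "?p (Suc m) > 0"
    using assms by auto
  have ratio: "real (Suc m) / (lam * ?p m) = 1 / ?p (Suc m)"
    using pmf_poisson_Suc[OF assms, of m] pos assms by (simp add: field_simps del: pmf_poisson)
  define x where "x = measure (poisson_pmf lam) (A \<inter> {..m}) -
    measure (poisson_pmf lam) A * measure (poisson_pmf lam) {..m}"
  have "real (Suc m) * poisson_stein lam A m = x * (real (Suc m) / (lam * ?p m))"
    by (simp add: poisson_stein_def x_def)
  also have "\<dots> = x / ?p (Suc m)"
    unfolding ratio by simp
  moreover have "lam * poisson_stein lam A (Suc m) =
      (x + (indicator A (Suc m) - measure (poisson_pmf lam) A) * ?p (Suc m)) / ?p (Suc m)"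
    using assms pos unfolding poisson_stein_def measure_pmf_Int_atMost_Suc measure_pmf_atMost_Suc x_def
    by (simp add: field_simps del: pmf_poisson)
  ultimately show ?thesis
    using pos Suc by (simp add: add_divide_distrib del: pmf_poisson)
qed

text \<open>The numerator is additive in \<open>A\<close> and vanishes for \<open>A = UNIV\<close>.
  By this symmetry an upper bound on the increments for all sets is also a lower bound.\<close>

lemma poisson_stein_Compl:
  assumes "0 < lam"
  shows "poisson_stein lam (- A) k = - poisson_stein lam A k"
proof -
  let ?P = "measure (poisson_pmf lam)"
  have "?P (- A) = 1 - ?P A"
    using measure_pmf.prob_compl[of A "poisson_pmf lam"] by (simp add: Compl_eq_Diff_UNIV)
  moreover have "?P (- A \<inter> {..k}) = ?P {..k} - ?P (A \<inter> {..k})"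
    using measure_pmf.finite_measure_Diff'[of "{..k}" "poisson_pmf lam" A]
    by (simp add: Diff_eq Int_commute)
  ultimately show ?thesis
    unfolding poisson_stein_def minus_divide_left by (simp add: left_diff_distrib)
qed

text \<open>The increment is linear in the masses of three pieces of \<open>A\<close>:
  \<open>a\<close> below \<open>Suc k\<close>, \<open>t * q\<close> at \<open>Suc k\<close>, and
  \<open>b\<close> above it. The tail estimate makes the coefficient of \<open>a\<close>
  nonpositive, the distribution function estimate that of \<open>b\<close>. Only the single point
  \<open>Suc k\<close> can push the increment up.\<close>

lemma poisson_stein_increment_le:
  assumes "0 < lam"
  shows "poisson_stein lam A (Suc k) - poisson_stein lam A k \<le> (1 - exp (- lam)) / lam"
proof -
  let ?p = "pmf (poisson_pmf lam)" and ?P = "measure (poisson_pmf lam)"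
  define F G where "F = ?P {..k}" and "G = ?P {..Suc k}"
  define q a b where "q = ?p (Suc k)" and "a = ?P (A \<inter> {..k})" and "b = ?P (A - {..Suc k})"
  define t :: real where "t = indicator A (Suc k)"
  have q: "q > 0"
    unfolding q_def using assms by simp
  have nonneg: "a \<ge> 0" "b \<ge> 0" "t \<ge> 0" "t \<le> 1"
    by (auto simp: a_def b_def t_def indicator_def)
  have G: "G = F + q"
    unfolding F_def G_def q_def by (rule measure_pmf_atMost_Suc)
  have "?P A = ?P (A \<inter> {..Suc k}) + b"
    using measure_pmf.finite_measure_Diff'[of A "poisson_pmf lam" "{..Suc k}"]
    by (simp add: b_def)
  then have PA: "?P A = a + t * q + b"
    unfolding measure_pmf_Int_atMost_Suc by (simp add: a_def t_def q_def)
  have sum: "?P {..m} = (\<Sum>i\<le>m. ?p i)" for m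
    by (rule measure_measure_pmf_finite) simp
  have cdf: "lam * F \<le> real (Suc k) * (G - exp (- lam))"
    using poisson_cdf_ratio_le[OF assms, of k] unfolding F_def G_def sum .
  have tail: "real (Suc k) * (1 - G) \<le> lam * (1 - F)"
    using poisson_tail_ratio_le[OF assms, of k] unfolding F_def G_def sum .
  have G1: "G \<le> 1"
    unfolding G_def by simp
  have new: "lam * q * poisson_stein lam A (Suc k) = (a + t * q) * (1 - G) - b * G"
    using assms q unfolding poisson_stein_def measure_pmf_Int_atMost_Suc PA
    by (simp add: F_def[symmetric] G_def[symmetric] a_def[symmetric] q_def[symmetric]
        t_def[symmetric] del: pmf_poisson) (simp add: algebra_simps)
  have pk: "lam * ?p k = real (Suc k) * q"
    unfolding q_def by (rule pmf_poisson_Suc[OF assms, symmetric])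
  have old: "real (Suc k) * q * poisson_stein lam A k = a * (1 - F) - (b + t * q) * F"
    using q unfolding poisson_stein_def PA pk
    by (simp add: F_def[symmetric] a_def[symmetric] del: pmf_poisson of_nat_Suc)
      (simp add: algebra_simps)
  \<comment> \<open>The denominators are \<open>lam * q\<close> for the new value and, by
    \<open>pk\<close>, \<open>real (Suc k) * q\<close> for the old one; this factor clears
    both.\<close>
  have "lam * real (Suc k) * q * (poisson_stein lam A (Suc k) - poisson_stein lam A k)
      = real (Suc k) * (lam * q * poisson_stein lam A (Suc k))
        - lam * (real (Suc k) * q * poisson_stein lam A k)"
    by (simp only: algebra_simps)
  also have "\<dots> = a * (real (Suc k) * (1 - G) - lam * (1 - F)) + b * (lam * F - real (Suc k) * G)
        + t * q * (real (Suc k) * (1 - G) + lam * F)"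
    unfolding new old by (simp only: algebra_simps)
  also have "\<dots> \<le> 0 + 0 + 1 * q * (real (Suc k) * (1 - exp (- lam)))"
  proof (intro add_mono mult_mono)
    show "a * (real (Suc k) * (1 - G) - lam * (1 - F)) \<le> 0"
      using nonneg tail by (intro mult_nonneg_nonpos) auto
    have "real (Suc k) * (G - exp (- lam)) \<le> real (Suc k) * G"
      by (intro mult_left_mono) auto
    with cdf have "lam * F \<le> real (Suc k) * G"
      by (rule order_trans)
    then show "b * (lam * F - real (Suc k) * G) \<le> 0"
      using nonneg by (intro mult_nonneg_nonpos) auto
    \<comment> \<open>The two occurrences of \<open>G\<close> cancel after \<open>cdf\<close> is
      applied, and the mass \<open>exp (- lam)\<close> missing there remains.\<close>
    show "real (Suc k) * (1 - G) + lam * F \<le> real (Suc k) * (1 - exp (- lam))"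
      using cdf by (simp add: algebra_simps)
    show "0 \<le> real (Suc k) * (1 - G) + lam * F"
      using assms G1 by (intro add_nonneg_nonneg mult_nonneg_nonneg) (auto simp: F_def)
  qed (use nonneg q in auto)
  also have "\<dots> = lam * real (Suc k) * q * ((1 - exp (- lam)) / lam)"
    using assms by simp
  finally show ?thesis
    using assms q by (subst (asm) mult_le_cancel_left_pos) auto
qed

text \<open>Both \<open>1 - exp (- lam) \<le> lam\<close> and \<open>1 - exp (- lam) \<le> 1\<close>
  hold, which gives the two cases of the maximum. The other sign comes from the complement of
  \<open>A\<close>.\<close>

lemma abs_poisson_stein_increment_le:
  assumes "0 < lam"
  shows "\<bar>poisson_stein lam A (Suc k) - poisson_stein lam A k\<bar> \<le> 1 / max 1 lam"
proof -
  have "(1 - exp (- lam)) / lam \<le> 1 / max 1 lam"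
    using assms exp_ge_add_one_self[of "- lam"] exp_ge_zero[of "- lam"]
    by (auto simp: max_def field_simps)
  then show ?thesis
    using poisson_stein_increment_le[OF assms, of A k] poisson_stein_increment_le[OF assms, of "- A" k]
    unfolding poisson_stein_Compl[OF assms] by linarith
qed

lemma abs_diff_le_if_abs_increment_le:
  fixes g :: "nat \<Rightarrow> real"
  assumes "\<And>k. \<bar>g (Suc k) - g k\<bar> \<le> D"
  shows "\<bar>g (m + k) - g m\<bar> \<le> D * real k"
proof (induction k)
  case (Suc k)
  then show ?case
    using assms[of "m + k"] by (simp add: algebra_simps)
qed simp

section \<open>Independence and the comparison for a single summand\<close>

context prob_space begin

text \<open>Every event determined by \<open>h (W \<omega>)\<close> is already an event of
  \<open>W\<close>. This serves to pass from the tuple of variables outside a neighbourhood to their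
  weighted sum, which has values in \<open>nat\<close> like \<open>Y i\<close>.\<close>

lemma indep_rv_compose:
  assumes "indep_rv S X T W" and h: "h \<in> measurable T U"
  shows "indep_rv S X U (\<lambda>\<omega>. h (W \<omega>))"
proof -
  have X: "random_variable S X" and W: "random_variable T W"
    and ind: "indep_set (sigma_sets (space M) {X -` A \<inter> space M | A. A \<in> sets S})
       (sigma_sets (space M) {W -` A \<inter> space M | A. A \<in> sets T})"
    using assms(1) unfolding indep_rv_def by auto
  have "{(\<lambda>\<omega>. h (W \<omega>)) -` A \<inter> space M | A. A \<in> sets U}
      \<subseteq> {W -` A \<inter> space M | A. A \<in> sets T}"
  proof safe
    fix A assume A: "A \<in> sets U"
    have "(\<lambda>\<omega>. h (W \<omega>)) -` A \<inter> space M = W -` (h -` A \<inter> space T) \<inter> space M"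
      using measurable_space[OF W] by auto
    then show "\<exists>B. (\<lambda>\<omega>. h (W \<omega>)) -` A \<inter> space M = W -` B \<inter> space M \<and> B \<in> sets T"
      using measurable_sets[OF h A] by blast
  qed
  then have sub: "sigma_sets (space M) {(\<lambda>\<omega>. h (W \<omega>)) -` A \<inter> space M | A. A \<in> sets U}
      \<subseteq> sigma_sets (space M) {W -` A \<inter> space M | A. A \<in> sets T}"
    by (rule sigma_sets_mono')
  show ?thesis
    unfolding indep_rv_def
  proof (intro conjI X measurable_compose[OF W h])
    show "indep_set (sigma_sets (space M) {X -` A \<inter> space M | A. A \<in> sets S})
       (sigma_sets (space M) {(\<lambda>\<omega>. h (W \<omega>)) -` A \<inter> space M | A. A \<in> sets U})"
      using ind unfolding indep_set_def
      by (rule indep_sets_mono_sets) (use sub in \<open>auto split: bool.split\<close>)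
  qed
qed

text \<open>The local error for one index: \<open>V\<close> is the part of the sum near
  \<open>Y\<close>, and \<open>W\<close> the independent rest. The increment bound makes
  \<open>g\<close> Lipschitz, so replacing \<open>W + V\<close> by \<open>W\<close> costs
  \<open>D * V\<close>, while replacing \<open>W + V - 1\<close> by \<open>W\<close> costs
  \<open>D * (V - 1)\<close> wherever \<open>Y\<close> is positive.\<close>

lemma local_stein_bound:
  fixes Y V W :: "'a \<Rightarrow> nat" and g :: "nat \<Rightarrow> real"
  assumes ind: "indep_var (count_space UNIV) Y (count_space UNIV) W"
    and V[measurable]: "V \<in> measurable M (count_space UNIV)"
    and le: "\<And>\<omega>. Y \<omega> \<le> V \<omega>"
    and intY: "integrable M (\<lambda>\<omega>. real (Y \<omega>))"
    and intV: "integrable M (\<lambda>\<omega>. real (V \<omega>))"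
    and intW: "integrable M (\<lambda>\<omega>. real (W \<omega>))"
    and intYV: "integrable M (\<lambda>\<omega>. real (Y \<omega>) * real (V \<omega>))"
    and g: "\<And>k. \<bar>g (Suc k) - g k\<bar> \<le> D"
  shows "integrable M (\<lambda>\<omega>. g (W \<omega> + V \<omega>))"
    and "integrable M (\<lambda>\<omega>. real (Y \<omega>) * g (W \<omega> + V \<omega> - 1))"
    and "\<bar>expectation (\<lambda>\<omega>. real (Y \<omega>)) * expectation (\<lambda>\<omega>. g (W \<omega> + V \<omega>))
        - expectation (\<lambda>\<omega>. real (Y \<omega>) * g (W \<omega> + V \<omega> - 1))\<bar>
      \<le> D * (expectation (\<lambda>\<omega>. real (Y \<omega>)) * expectation (\<lambda>\<omega>. real (V \<omega>))
          + expectation (\<lambda>\<omega>. real (Y \<omega>) * real (V \<omega>)) - expectation (\<lambda>\<omega>. real (Y \<omega>)))"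
proof -
  have Y[measurable]: "Y \<in> measurable M (count_space UNIV)"
    and W[measurable]: "W \<in> measurable M (count_space UNIV)"
    using indep_var_rv1[OF ind] indep_var_rv2[OF ind] by auto
  note lip = abs_diff_le_if_abs_increment_le[of g D, OF g]
  have D: "0 \<le> D"
    using g[of 0] by linarith
  have growth: "\<bar>g k\<bar> \<le> \<bar>g 0\<bar> + D * real k" for k
    using lip[of 0 k] by simp
  have intgW: "integrable M (\<lambda>\<omega>. g (W \<omega>))"
    by (rule Bochner_Integration.integrable_bound[where f="\<lambda>\<omega>. \<bar>g 0\<bar> + D * real (W \<omega>)"])
      (use intW growth D in \<open>auto intro!: order_trans[OF growth]\<close>)
  show intgZ: "integrable M (\<lambda>\<omega>. g (W \<omega> + V \<omega>))"
    by (rule Bochner_Integration.integrable_bound[where f="\<lambda>\<omega>. \<bar>g 0\<bar> + D * (real (W \<omega>) + real (V \<omega>))"])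
      (use intW intV D in \<open>auto intro!: order_trans[OF growth]\<close>)
  have ind_comp: "indep_var borel (\<lambda>\<omega>. real (Y \<omega>)) borel (\<lambda>\<omega>. f (W \<omega>))" for f :: "nat \<Rightarrow> real"
    using indep_var_compose[OF ind, of real borel f borel] by (simp add: comp_def)
  have intYg: "integrable M (\<lambda>\<omega>. real (Y \<omega>) * g (W \<omega>))"
    by (rule indep_var_integrable[OF ind_comp intY intgW])
  have first: "\<bar>expectation (\<lambda>\<omega>. g (W \<omega> + V \<omega>)) - expectation (\<lambda>\<omega>. g (W \<omega>))\<bar>
      \<le> D * expectation (\<lambda>\<omega>. real (V \<omega>))"
  proof -
    have "\<bar>expectation (\<lambda>\<omega>. g (W \<omega> + V \<omega>) - g (W \<omega>))\<bar> \<le> expectation (\<lambda>\<omega>. D * real (V \<omega>))"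
      by (intro order_trans[OF integral_abs_bound integral_mono]) (auto intro!: intgZ intgW intV lip)
    then show ?thesis
      using intgZ intgW by simp
  qed
  \<comment> \<open>Where \<open>Y\<close> is 0 both sides vanish, so the truncated subtraction does
    no harm. Elsewhere \<open>V \<ge> Y \<ge> 1\<close>, and \<open>W + V - 1\<close> lies exactly
    \<open>V - 1\<close> steps above \<open>W\<close>.\<close>
  have key: "\<bar>real (Y \<omega>) * g (W \<omega>) - real (Y \<omega>) * g (W \<omega> + V \<omega> - 1)\<bar>
      \<le> D * (real (Y \<omega>) * real (V \<omega>) - real (Y \<omega>))" for \<omega>
  proof (cases "Y \<omega> = 0")
    case False
    then have "V \<omega> \<ge> 1"
      using le[of \<omega>] by simp
    then have "\<bar>g (W \<omega>) - g (W \<omega> + V \<omega> - 1)\<bar> \<le> D * (real (V \<omega>) - 1)"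
      using lip[of "W \<omega>" "V \<omega> - 1"] by (simp add: abs_minus_commute of_nat_diff)
    then have "real (Y \<omega>) * \<bar>g (W \<omega>) - g (W \<omega> + V \<omega> - 1)\<bar> \<le> real (Y \<omega>) * (D * (real (V \<omega>) - 1))"
      by (rule mult_left_mono) simp
    moreover have "real (Y \<omega>) * (D * (real (V \<omega>) - 1)) = D * (real (Y \<omega>) * real (V \<omega>) - real (Y \<omega>))"
      by (simp add: algebra_simps)
    ultimately show ?thesis
      unfolding right_diff_distrib[symmetric] abs_mult by simp
  qed simp
  \<comment> \<open>Integrability of \<open>Y * g (W + V - 1)\<close> is obtained indirectly:
    independence gives it for \<open>Y * g W\<close>, and the difference of the two is dominated
    through \<open>key\<close>.\<close>
  have intdiff: "integrable M (\<lambda>\<omega>. real (Y \<omega>) * g (W \<omega>) - real (Y \<omega>) * g (W \<omega> + V \<omega> - 1))"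
  proof (rule Bochner_Integration.integrable_bound[where f="\<lambda>\<omega>. D * (real (Y \<omega>) * real (V \<omega>) - real (Y \<omega>))"])
    show "AE \<omega> in M. norm (real (Y \<omega>) * g (W \<omega>) - real (Y \<omega>) * g (W \<omega> + V \<omega> - 1))
        \<le> norm (D * (real (Y \<omega>) * real (V \<omega>) - real (Y \<omega>)))"
      unfolding real_norm_def by (intro AE_I2 order_trans[OF key abs_ge_self])
  qed (use intYV intY in auto)
  show intYgZ: "integrable M (\<lambda>\<omega>. real (Y \<omega>) * g (W \<omega> + V \<omega> - 1))"
    using Bochner_Integration.integrable_diff[OF intYg intdiff] by simp
  have second: "\<bar>expectation (\<lambda>\<omega>. real (Y \<omega>) * g (W \<omega>))
        - expectation (\<lambda>\<omega>. real (Y \<omega>) * g (W \<omega> + V \<omega> - 1))\<bar>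
      \<le> D * (expectation (\<lambda>\<omega>. real (Y \<omega>) * real (V \<omega>)) - expectation (\<lambda>\<omega>. real (Y \<omega>)))"
  proof -
    have "\<bar>expectation (\<lambda>\<omega>. real (Y \<omega>) * g (W \<omega>) - real (Y \<omega>) * g (W \<omega> + V \<omega> - 1))\<bar>
        \<le> expectation (\<lambda>\<omega>. D * (real (Y \<omega>) * real (V \<omega>) - real (Y \<omega>)))"
      using intYV intY intdiff
      by (intro order_trans[OF integral_abs_bound integral_mono] integrable_abs key) auto
    then show ?thesis
      using intYg intYgZ intYV intY by simp
  qed
  have EY: "0 \<le> expectation (\<lambda>\<omega>. real (Y \<omega>))"
    by simp
  \<comment> \<open>Independence factorises the common reference value, so that \<open>first\<close>
    and \<open>second\<close> can be joined by the triangle inequality.\<close>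
  have "expectation (\<lambda>\<omega>. real (Y \<omega>) * g (W \<omega>)) =
      expectation (\<lambda>\<omega>. real (Y \<omega>)) * expectation (\<lambda>\<omega>. g (W \<omega>))"
    by (rule indep_var_lebesgue_integral[OF ind_comp intY intgW])
  then have "expectation (\<lambda>\<omega>. real (Y \<omega>)) * expectation (\<lambda>\<omega>. g (W \<omega> + V \<omega>))
        - expectation (\<lambda>\<omega>. real (Y \<omega>) * g (W \<omega> + V \<omega> - 1)) =
      expectation (\<lambda>\<omega>. real (Y \<omega>)) *
        (expectation (\<lambda>\<omega>. g (W \<omega> + V \<omega>)) - expectation (\<lambda>\<omega>. g (W \<omega>)))
      + (expectation (\<lambda>\<omega>. real (Y \<omega>) * g (W \<omega>))
        - expectation (\<lambda>\<omega>. real (Y \<omega>) * g (W \<omega> + V \<omega> - 1)))" (is "?l = ?x * ?y + ?z")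
    by (simp add: algebra_simps)
  moreover have "\<bar>?x * ?y\<bar> \<le> ?x * (D * expectation (\<lambda>\<omega>. real (V \<omega>)))"
    unfolding abs_mult using first EY by (simp add: mult_left_mono)
  ultimately have "\<bar>?l\<bar> \<le> ?x * (D * expectation (\<lambda>\<omega>. real (V \<omega>)))
      + D * (expectation (\<lambda>\<omega>. real (Y \<omega>) * real (V \<omega>)) - expectation (\<lambda>\<omega>. real (Y \<omega>)))"
    using second by linarith
  then show "\<bar>?l\<bar> \<le> D * (?x * expectation (\<lambda>\<omega>. real (V \<omega>))
          + expectation (\<lambda>\<omega>. real (Y \<omega>) * real (V \<omega>)) - ?x)"
    by (simp add: algebra_simps)
qed

end

section \<open>Extended expectations and integrability\<close>

lemma ext_expectation_eq_expectation:
  assumes "integrable M (\<lambda>\<omega>. real (X \<omega>))"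
  shows "ext_expectation M X = ereal (\<integral>\<omega>. real (X \<omega>) \<partial>M)"
proof -
  have "(\<integral>\<^sup>+ \<omega>. of_nat (X \<omega>) \<partial>M) = ennreal (\<integral>\<omega>. real (X \<omega>) \<partial>M)"
    using nn_integral_eq_integral[OF assms] by (simp add: ennreal_of_nat_eq_real_of_nat)
  then show ?thesis
    by (simp add: ext_expectation_def)
qed

lemma ext_expectation_finite_iff:
  assumes "X \<in> measurable M (count_space UNIV)"
  shows "ext_expectation M X < \<infinity> \<longleftrightarrow> integrable M (\<lambda>\<omega>. real (X \<omega>))"
proof
  assume "ext_expectation M X < \<infinity>"
  then have "(\<integral>\<^sup>+ \<omega>. of_nat (X \<omega>) \<partial>M) < \<infinity>"
    by (simp add: ext_expectation_def less_ennreal.rep_eq)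
  then show "integrable M (\<lambda>\<omega>. real (X \<omega>))"
    using assms by (intro integrableI_bounded) (auto simp: ennreal_of_nat_eq_real_of_nat)
qed (simp add: ext_expectation_eq_expectation)


section \<open>The bound for finite mixed moments\<close>

text \<open>Since \<open>Z\<close> and \<open>lam\<close> are sums over \<open>I\<close> with the
  same weights \<open>c i\<close>, the expectation of the Stein equation at \<open>Z\<close> splits
  into local errors, one for each index, and \<open>local_stein_bound\<close> controls each of them
  uniformly in \<open>A\<close>.\<close>

lemma (in prob_space) local_dependence_poisson_bound:
  fixes Y :: "nat \<Rightarrow> 'a \<Rightarrow> nat" and c :: "nat \<Rightarrow> nat" and N :: "nat \<Rightarrow> nat set"
  assumes I: "finite I"
    and Y[measurable]: "\<And>i. i \<in> I \<Longrightarrow> Y i \<in> measurable M (count_space UNIV)"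
    and c: "\<And>i. i \<in> I \<Longrightarrow> c i \<ge> 1"
    and N: "\<And>i. i \<in> I \<Longrightarrow> N i \<subseteq> I" "\<And>i. i \<in> I \<Longrightarrow> i \<in> N i"
    and ind: "\<And>i. i \<in> I \<Longrightarrow> indep_rv (count_space UNIV) (Y i)
        (\<Pi>\<^sub>M j\<in>I - N i. count_space UNIV) (\<lambda>\<omega>. \<lambda>j\<in>I - N i. Y j \<omega>)"
    and Z: "Z = (\<lambda>\<omega>. \<Sum>i\<in>I. c i * Y i \<omega>)"
    and int1: "\<And>i. i \<in> I \<Longrightarrow> integrable M (\<lambda>\<omega>. real (Y i \<omega>))"
    and int2: "\<And>i j. i \<in> I \<Longrightarrow> j \<in> N i \<Longrightarrow> integrable M (\<lambda>\<omega>. real (Y i \<omega>) * real (Y j \<omega>))"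
    and lam: "lam = expectation (\<lambda>\<omega>. real (Z \<omega>))" "0 < lam"
  shows "tv_dist (distr M (count_space UNIV) Z) (poisson_pmf lam) \<le>
    1 / max 1 lam * (\<Sum>i\<in>I. (\<Sum>j\<in>N i. real (c i * c j) *
        (expectation (\<lambda>\<omega>. real (Y i \<omega>) * real (Y j \<omega>))
          + expectation (\<lambda>\<omega>. real (Y i \<omega>)) * expectation (\<lambda>\<omega>. real (Y j \<omega>))))
      - real (c i) * expectation (\<lambda>\<omega>. real (Y i \<omega>)))"
  unfolding tv_dist_def
proof (rule cSUP_least)
  fix A :: "nat set"
  define g where "g = poisson_stein lam A"
  define D where "D = 1 / max 1 lam"
  define W V where "W i \<omega> = (\<Sum>j\<in>I - N i. c j * Y j \<omega>)" and "V i \<omega> = (\<Sum>j\<in>N i. c j * Y j \<omega>)" for i \<omega>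
  define e where "e i = expectation (\<lambda>\<omega>. real (Y i \<omega>))" for i
  have finN: "finite (N i)" if "i \<in> I" for i
    using N(1)[OF that] I by (rule finite_subset)
  have split: "W i \<omega> + V i \<omega> = Z \<omega>" if "i \<in> I" for i \<omega>
    unfolding W_def V_def Z by (rule sum.subset_diff[OF N(1)[OF that] I, symmetric])
  have Zm: "Z \<in> measurable M (count_space UNIV)"
    unfolding Z by measurable
  have Vm: "V i \<in> measurable M (count_space UNIV)" if "i \<in> I" for i
  proof -
    have [measurable]: "Y j \<in> measurable M (count_space UNIV)" if "j \<in> N i" for j
      using N(1)[OF \<open>i \<in> I\<close>] that Y by blast
    show ?thesis
      unfolding V_def by measurable
  qed
  \<comment> \<open>Here \<open>c i \<ge> 1\<close> and \<open>i \<in> N i\<close> enter; the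
    domination is what permits the negative term of the bound.\<close>
  have YV: "Y i \<omega> \<le> V i \<omega>" if "i \<in> I" for i \<omega>
  proof -
    have "Y i \<omega> \<le> c i * Y i \<omega>"
      using c[OF that] by simp
    also have "\<dots> \<le> V i \<omega>"
      unfolding V_def using finN[OF that] N(2)[OF that] by (intro member_le_sum) auto
    finally show ?thesis .
  qed
  have intN: "integrable M (\<lambda>\<omega>. real (Y j \<omega>))" if "i \<in> I" "j \<in> N i" for i j
    using N(1) that by (intro int1) auto
  have intV: "integrable M (\<lambda>\<omega>. real (V i \<omega>))" if "i \<in> I" for i
    unfolding V_def using intN[OF that] by simp
  have intW: "integrable M (\<lambda>\<omega>. real (W i \<omega>))" for i
    unfolding W_def of_nat_sum of_nat_mult using int1
    by (intro Bochner_Integration.integrable_sum integrable_mult_right) auto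
  have EV: "expectation (\<lambda>\<omega>. real (V i \<omega>)) = (\<Sum>j\<in>N i. real (c j) * e j)" if "i \<in> I" for i
    unfolding V_def e_def of_nat_sum of_nat_mult using intN[OF that]
    by (subst Bochner_Integration.integral_sum) auto
  have YV_eq: "(\<lambda>\<omega>. real (Y i \<omega>) * real (V i \<omega>)) = (\<lambda>\<omega>. \<Sum>j\<in>N i. real (c j) * (real (Y i \<omega>) * real (Y j \<omega>)))" for i
    unfolding V_def by (simp add: sum_distrib_left mult_ac)
  have intYV: "integrable M (\<lambda>\<omega>. real (Y i \<omega>) * real (V i \<omega>))" if "i \<in> I" for i
    unfolding YV_eq using int2[OF that] by auto
  have EYV: "expectation (\<lambda>\<omega>. real (Y i \<omega>) * real (V i \<omega>)) =
      (\<Sum>j\<in>N i. real (c j) * expectation (\<lambda>\<omega>. real (Y i \<omega>) * real (Y j \<omega>)))" if "i \<in> I" for i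
    unfolding YV_eq using int2[OF that]
    by (subst Bochner_Integration.integral_sum) auto
  have indW: "indep_var (count_space UNIV) (Y i) (count_space UNIV) (W i)" if "i \<in> I" for i
  proof -
    have "(\<lambda>v. \<Sum>j\<in>I - N i. c j * v j) \<in> measurable (\<Pi>\<^sub>M j\<in>I - N i. count_space UNIV) (count_space UNIV)"
      by measurable
    from indep_rv_compose[OF ind[OF that] this] show ?thesis
      by (simp add: W_def[abs_def] flip: indep_rv_eq_indep_var)
  qed
  have g: "\<bar>g (Suc k) - g k\<bar> \<le> D" for k
    unfolding g_def D_def by (rule abs_poisson_stein_increment_le[OF lam(2)])
  have stein: "integrable M (\<lambda>\<omega>. g (Z \<omega>))"
      "integrable M (\<lambda>\<omega>. real (Y i \<omega>) * g (Z \<omega> - 1))"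
      "\<bar>e i * expectation (\<lambda>\<omega>. g (Z \<omega>)) - expectation (\<lambda>\<omega>. real (Y i \<omega>) * g (Z \<omega> - 1))\<bar>
        \<le> D * (e i * (\<Sum>j\<in>N i. real (c j) * e j)
          + (\<Sum>j\<in>N i. real (c j) * expectation (\<lambda>\<omega>. real (Y i \<omega>) * real (Y j \<omega>))) - e i)"
    if i: "i \<in> I" for i
    using local_stein_bound[where g = g and D = D,
        OF indW[OF i] Vm[OF i] YV[OF i] int1[OF i] intV[OF i] intW intYV[OF i] g]
    unfolding split[OF i] EV[OF i] EYV[OF i] e_def .
  \<comment> \<open>\<open>stein(1)\<close> is available only through some index; for empty
    \<open>I\<close> the variable \<open>Z\<close> is constant.\<close>
  have intg: "integrable M (\<lambda>\<omega>. g (Z \<omega>))"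
  proof (cases "I = {}")
    case False
    then show ?thesis
      using stein(1) by blast
  qed (simp add: Z)
  have Zg_eq: "(\<lambda>\<omega>. real (Z \<omega>) * g (Z \<omega> - 1)) = (\<lambda>\<omega>. \<Sum>i\<in>I. real (c i) * (real (Y i \<omega>) * g (Z \<omega> - 1)))"
    by (simp add: Z sum_distrib_right mult_ac)
  have intZg: "integrable M (\<lambda>\<omega>. real (Z \<omega>) * g (Z \<omega> - 1))"
    unfolding Zg_eq using stein(2) by auto
  have lam_eq: "lam = (\<Sum>i\<in>I. real (c i) * e i)"
    unfolding lam(1) Z e_def of_nat_sum of_nat_mult using int1
    by (subst Bochner_Integration.integral_sum) auto
  have "measure (distr M (count_space UNIV) Z) A - measure (poisson_pmf lam) A =
      expectation (\<lambda>\<omega>. indicator A (Z \<omega>) - measure (poisson_pmf lam) A)"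
  proof -
    have "measure (distr M (count_space UNIV) Z) A = expectation (indicator (Z -` A \<inter> space M))"
      using Zm by (simp add: measure_distr measurable_sets)
    also have "\<dots> = expectation (\<lambda>\<omega>. indicator A (Z \<omega>))"
      by (intro Bochner_Integration.integral_cong) (auto simp: indicator_def)
    finally show ?thesis
      using Zm by (subst Bochner_Integration.integral_diff)
        (auto simp: prob_space intro!: integrable_const_bound[where B = 1] measurable_compose[OF Zm])
  qed
  \<comment> \<open>The Stein equation is applied pointwise at \<open>Z \<omega>\<close>. With
    \<open>f (k + 1) = g k\<close> the integrand is the usual
    \<open>lam * f (Z + 1) - Z * f Z\<close>.\<close>
  also have "\<dots> = expectation (\<lambda>\<omega>. lam * g (Z \<omega>) - real (Z \<omega>) * g (Z \<omega> - 1))"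
    unfolding g_def poisson_stein_equation[OF lam(2)] ..
  also have "\<dots> = lam * expectation (\<lambda>\<omega>. g (Z \<omega>)) - expectation (\<lambda>\<omega>. real (Z \<omega>) * g (Z \<omega> - 1))"
    using intg intZg by simp
  also have "expectation (\<lambda>\<omega>. real (Z \<omega>) * g (Z \<omega> - 1)) =
      (\<Sum>i\<in>I. real (c i) * expectation (\<lambda>\<omega>. real (Y i \<omega>) * g (Z \<omega> - 1)))"
    unfolding Zg_eq using stein(2)
    by (subst Bochner_Integration.integral_sum) auto
  also have "lam * expectation (\<lambda>\<omega>. g (Z \<omega>)) - \<dots> =
      (\<Sum>i\<in>I. real (c i) * (e i * expectation (\<lambda>\<omega>. g (Z \<omega>)) - expectation (\<lambda>\<omega>. real (Y i \<omega>) * g (Z \<omega> - 1))))"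
    unfolding lam_eq sum_distrib_right right_diff_distrib sum_subtractf mult.assoc ..
  also have "\<bar>\<dots>\<bar> \<le> (\<Sum>i\<in>I. real (c i) * (D * (e i * (\<Sum>j\<in>N i. real (c j) * e j)
        + (\<Sum>j\<in>N i. real (c j) * expectation (\<lambda>\<omega>. real (Y i \<omega>) * real (Y j \<omega>))) - e i)))"
    using stein(3) by (intro order_trans[OF sum_abs] sum_mono) (auto simp: abs_mult intro: mult_left_mono)
  also have "\<dots> = D * (\<Sum>i\<in>I. (\<Sum>j\<in>N i. real (c i * c j) *
        (expectation (\<lambda>\<omega>. real (Y i \<omega>) * real (Y j \<omega>)) + e i * e j)) - real (c i) * e i)"
    unfolding sum_distrib_left
    by (intro sum.cong refl) (simp add: algebra_simps sum.distrib sum_distrib_left)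
  finally show "\<bar>measure (distr M (count_space UNIV) Z) A - measure (poisson_pmf lam) A\<bar> \<le>
    1 / max 1 lam * (\<Sum>i\<in>I. (\<Sum>j\<in>N i. real (c i * c j) *
        (expectation (\<lambda>\<omega>. real (Y i \<omega>) * real (Y j \<omega>))
          + expectation (\<lambda>\<omega>. real (Y i \<omega>)) * expectation (\<lambda>\<omega>. real (Y j \<omega>))))
      - real (c i) * expectation (\<lambda>\<omega>. real (Y i \<omega>)))"
    unfolding e_def D_def .
qed simp

section \<open>The extended-valued bound\<close>

theorem theorem2p1:
  fixes M :: "'a measure"
    and n :: nat
    and Y :: "nat \<Rightarrow> 'a \<Rightarrow> nat"
    and c :: "nat \<Rightarrow> nat"
    and \<A> :: "nat \<Rightarrow> nat set"
    and Z :: "'a \<Rightarrow> nat"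
    and lam :: real
  assumes "prob_space M"
    and "n \<ge> 1"
    and "\<And>i. i \<in> {1..n} \<Longrightarrow> Y i \<in> measurable M (count_space UNIV)"
    and "\<And>i. i \<in> {1..n} \<Longrightarrow> c i \<ge> 1"
    and "\<exists>i\<in>{1..n}. c i = 1"
    and "\<And>i. i \<in> {1..n} \<Longrightarrow> \<A> i \<subseteq> {1..n}"
    and "\<And>i. i \<in> {1..n} \<Longrightarrow> i \<in> \<A> i"
    and "\<And>i. i \<in> {1..n} \<Longrightarrow>
           prob_space.indep_rv M
             (count_space UNIV) (Y i)
             (\<Pi>\<^sub>M j\<in>{1..n} - \<A> i. count_space UNIV) (\<lambda>\<omega>. \<lambda>j\<in>{1..n} - \<A> i. Y j \<omega>)"
    and "Z = (\<lambda>\<omega>. \<Sum>i=1..n. c i * Y i \<omega>)"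
    and "ereal lam = ext_expectation M Z"
    and "0 < lam"
  shows "ereal (tv_dist (distr M (count_space UNIV) Z) (measure_pmf (poisson_pmf lam)))
    \<le> ereal (1 / max 1 lam) *
       (\<Sum>i=1..n.
          (\<Sum>j\<in>\<A> i. ereal (real (c i * c j)) *
             (ext_expectation M (\<lambda>\<omega>. Y i \<omega> * Y j \<omega>)
              + ext_expectation M (Y i) * ext_expectation M (Y j)))
          - ereal (real (c i)) * ext_expectation M (Y i))"
proof -
  interpret prob_space M
    by fact
  note [measurable] = assms(3)
  have [measurable]: "Z \<in> measurable M (count_space UNIV)"
    unfolding assms(9) by measurable
  have intZ: "integrable M (\<lambda>\<omega>. real (Z \<omega>))"
    using ext_expectation_finite_iff[of Z M] assms(10)[symmetric] by simp
  have lam_eq: "lam = expectation (\<lambda>\<omega>. real (Z \<omega>))"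
    using assms(10) ext_expectation_eq_expectation[OF intZ] by simp
  \<comment> \<open>As \<open>c i \<ge> 1\<close>, each \<open>Y i\<close> is at most
    \<open>Z\<close>, whose mean is the real number \<open>lam\<close>.\<close>
  have int1: "integrable M (\<lambda>\<omega>. real (Y i \<omega>))" if i: "i \<in> {1..n}" for i
  proof (rule Bochner_Integration.integrable_bound[OF intZ])
    have "Y i \<omega> \<le> Z \<omega>" for \<omega>
    proof -
      have "Y i \<omega> \<le> c i * Y i \<omega>"
        using assms(4)[OF i] by simp
      also have "\<dots> \<le> Z \<omega>"
        unfolding assms(9) using i by (intro member_le_sum) auto
      finally show ?thesis .
    qed
    then show "AE \<omega> in M. norm (real (Y i \<omega>)) \<le> norm (real (Z \<omega>))"
      by simp
  qed (use i in measurable)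
  note ext1 = ext_expectation_eq_expectation[OF int1]
  have fin: "finite (\<A> i)" if "i \<in> {1..n}" for i
    using assms(6)[OF that] by (rule finite_subset) simp
  show ?thesis
  \<comment> \<open>With all local mixed moments finite, both sides are real and the previous bound
    transfers; otherwise the right-hand side is infinite.\<close>
  proof (cases "\<forall>i\<in>{1..n}. \<forall>j\<in>\<A> i. ext_expectation M (\<lambda>\<omega>. Y i \<omega> * Y j \<omega>) < \<infinity>")
    case True
    have int2: "integrable M (\<lambda>\<omega>. real (Y i \<omega> * Y j \<omega>))" if "i \<in> {1..n}" "j \<in> \<A> i" for i j
    proof -
      have "j \<in> {1..n}"
        using that assms(6) by blast
      with that have "(\<lambda>\<omega>. Y i \<omega> * Y j \<omega>) \<in> measurable M (count_space UNIV)"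
        by measurable
      then show ?thesis
        using True that ext_expectation_finite_iff by blast
    qed
    have "ereal (tv_dist (distr M (count_space UNIV) Z) (measure_pmf (poisson_pmf lam))) \<le>
      ereal (1 / max 1 lam * (\<Sum>i=1..n. (\<Sum>j\<in>\<A> i. real (c i * c j) *
        (expectation (\<lambda>\<omega>. real (Y i \<omega>) * real (Y j \<omega>))
          + expectation (\<lambda>\<omega>. real (Y i \<omega>)) * expectation (\<lambda>\<omega>. real (Y j \<omega>))))
      - real (c i) * expectation (\<lambda>\<omega>. real (Y i \<omega>))))"
      unfolding ereal_less_eq
      by (rule local_dependence_poisson_bound)
        (use assms int1 int2 lam_eq in simp_all)
    also have "\<dots> = ereal (1 / max 1 lam) *
       (\<Sum>i=1..n.
          (\<Sum>j\<in>\<A> i. ereal (real (c i * c j)) *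
             (ext_expectation M (\<lambda>\<omega>. Y i \<omega> * Y j \<omega>)
              + ext_expectation M (Y i) * ext_expectation M (Y j)))
          - ereal (real (c i)) * ext_expectation M (Y i))"
      unfolding times_ereal.simps(1)[symmetric] sum_ereal[symmetric]
    proof (intro arg_cong2[where f = "(*)"] refl sum.cong)
      fix i assume i: "i \<in> {1..n}"
      have "ereal (real (c i * c j)) * (ext_expectation M (\<lambda>\<omega>. Y i \<omega> * Y j \<omega>)
              + ext_expectation M (Y i) * ext_expectation M (Y j)) =
          ereal (real (c i * c j) * (expectation (\<lambda>\<omega>. real (Y i \<omega>) * real (Y j \<omega>))
          + expectation (\<lambda>\<omega>. real (Y i \<omega>)) * expectation (\<lambda>\<omega>. real (Y j \<omega>))))" if j: "j \<in> \<A> i" for j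
      proof -
        have "j \<in> {1..n}"
          using i j assms(6) by blast
        then show ?thesis
          by (simp add: ext1[OF i] ext1[OF \<open>j \<in> {1..n}\<close>] ext_expectation_eq_expectation[OF int2[OF i j]])
      qed
      then show "ereal ((\<Sum>j\<in>\<A> i. real (c i * c j) *
        (expectation (\<lambda>\<omega>. real (Y i \<omega>) * real (Y j \<omega>))
          + expectation (\<lambda>\<omega>. real (Y i \<omega>)) * expectation (\<lambda>\<omega>. real (Y j \<omega>))))
        - real (c i) * expectation (\<lambda>\<omega>. real (Y i \<omega>))) =
        (\<Sum>j\<in>\<A> i. ereal (real (c i * c j)) *
             (ext_expectation M (\<lambda>\<omega>. Y i \<omega> * Y j \<omega>)
              + ext_expectation M (Y i) * ext_expectation M (Y j)))
          - ereal (real (c i)) * ext_expectation M (Y i)"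
        by (simp add: ext1[OF i])
    qed
    finally show ?thesis .
  next
    case False
    then obtain i j where i: "i \<in> {1..n}" and j: "j \<in> \<A> i"
      and inf: "ext_expectation M (\<lambda>\<omega>. Y i \<omega> * Y j \<omega>) = \<infinity>"
      by auto
    have j': "j \<in> {1..n}"
      using i j assms(6) by blast
    \<comment> \<open>The coefficient must be nonzero, because \<open>0 * \<infinity> = 0\<close> in
      \<open>ereal\<close>; this follows from \<open>c i \<ge> 1\<close> and
      \<open>c j \<ge> 1\<close>.\<close>
    have "ereal (real (c i * c j)) * (ext_expectation M (\<lambda>\<omega>. Y i \<omega> * Y j \<omega>)
              + ext_expectation M (Y i) * ext_expectation M (Y j)) = \<infinity>"
      using assms(4)[OF i] assms(4)[OF j'] by (simp add: inf ext1[OF i] ext1[OF j'])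
    then have "(\<Sum>j\<in>\<A> i. ereal (real (c i * c j)) * (ext_expectation M (\<lambda>\<omega>. Y i \<omega> * Y j \<omega>)
              + ext_expectation M (Y i) * ext_expectation M (Y j))) = \<infinity>"
      unfolding sum_Pinfty using fin[OF i] j by blast
    \<comment> \<open>The subtracted mean is finite, so it cannot offset the infinite sum.\<close>
    then have "(\<Sum>j\<in>\<A> i. ereal (real (c i * c j)) * (ext_expectation M (\<lambda>\<omega>. Y i \<omega> * Y j \<omega>)
              + ext_expectation M (Y i) * ext_expectation M (Y j)))
          - ereal (real (c i)) * ext_expectation M (Y i) = \<infinity>"
      by (simp add: ext1[OF i])
    then have "(\<Sum>i=1..n.
          (\<Sum>j\<in>\<A> i. ereal (real (c i * c j)) *
             (ext_expectation M (\<lambda>\<omega>. Y i \<omega> * Y j \<omega>)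
              + ext_expectation M (Y i) * ext_expectation M (Y j)))
          - ereal (real (c i)) * ext_expectation M (Y i)) = \<infinity>"
      unfolding sum_Pinfty using i by blast
    then show ?thesis
      by simp
  qed
qed

end
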